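(* Let $f:\mathbb{R}^N\to\mathbb{R}$ be twice continuously differentiable with $\|\nabla^2 f(x)\|_2\le L$ for all $x\in\mathbb{R}^N$ (where $L>0$), and $\inf_{x\in\mathbb{R}^N} f(x)>-\infty$. Let $0<\beta<1$ and $$0<\gamma<\frac{2(1-\beta)}{L}.$$ For $(x^0,x^1)\in\mathbb{R}^N\times\mathbb{R}^N$ let $(x^k)_{k\ge 0}$ be the sequence generated by heavy-ball gradient descent (HBGD), $$x^{k+1}=x^k-\gamma\nabla f(x^k)+\beta(x^k-x^{k-1}),\qquad k\ge 1.$$ Then $$\mu\{(x^0,x^1)\in\mathbb{R}^{2N}:\ \lim_{k}x^k\in\chi^*_f\}=0,$$ that is, $\mu(W_{\mathrm{HBGD}})=0$.
   Context: $\|\cdot\|_2$ is the spectral norm and $\mu$ is Lebesgue measure. A point $x^*$ is a critical point of $f$ if $\nabla f(x^* )=0$; it is a strict saddle point of $f$ if it is a critical point and $\lambda_{\min}(\nabla^2 f(x^* ))<0$. $\chi^*_f$ denotes the set of strict saddle points of $f$. The condition $\lim_k x^k\in\chi^*_f$ means that the limit exists and belongs to $\chi^*_f$. For an iterative algorithm $\mathcal{M}$, $W_{\mathcal{M}}$ is the set of initial conditions from which the iterates converge to a strict saddle point; for HBGD the initial condition is the pair $(x^0,x^1)$, so $W_{\mathrm{HBGD}}=\{(x^0,x^1)\in\mathbb{R}^{2N}:\lim_k x^k\in\chi^*_f\}$. *)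

theory Defs
  imports "HOL-Analysis.Analysis"
begin

definition gradient :: "(real^'n \<Rightarrow> real) \<Rightarrow> real^'n \<Rightarrow> real^'n" where
  "gradient f x = (THE D. GDERIV f x :> D)"

text \<open>The Hessian is the Jacobian matrix of the gradient. It is meaningful only where
  \<open>f\<close> and its gradient are differentiable; \<open>C2\<close> below guarantees this everywhere.\<close>

definition hessian :: "(real^'n \<Rightarrow> real) \<Rightarrow> real^'n \<Rightarrow> real^'n^'n" where
  "hessian f x = matrix (frechet_derivative (gradient f) (at x))"

definition C2 :: "(real^'n \<Rightarrow> real) \<Rightarrow> bool" where
  "C2 f \<longleftrightarrow> (\<forall>x. f differentiable (at x)) \<and> (\<forall>x. gradient f differentiable (at x))
     \<and> continuous_on UNIV (hessian f)"

text \<open>The norm of \<open>real^'n\<close> is Euclidean, so the operator norm is the spectral norm. (The type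
  class norm on \<open>real^'n^'n\<close> would be the Frobenius norm.)\<close>

definition spectral_norm :: "real^'n^'n \<Rightarrow> real" where
  "spectral_norm A = onorm (\<lambda>v. A *v v)"

definition eigenvalues :: "real^'n^'n \<Rightarrow> real set" where
  "eigenvalues A = {l. \<exists>v. v \<noteq> 0 \<and> A *v v = l *\<^sub>R v}"

text \<open>Used for symmetric matrices, whose set of eigenvalues is finite and nonempty.\<close>

definition lambda_min :: "real^'n^'n \<Rightarrow> real" where
  "lambda_min A = Min (eigenvalues A)"

definition critical_point :: "(real^'n \<Rightarrow> real) \<Rightarrow> real^'n \<Rightarrow> bool" where
  "critical_point f x \<longleftrightarrow> gradient f x = 0"

definition strict_saddles :: "(real^'n \<Rightarrow> real) \<Rightarrow> (real^'n) set" where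
  "strict_saddles f = {x. critical_point f x \<and> lambda_min (hessian f x) < 0}"

fun hbgd :: "(real^'n \<Rightarrow> real) \<Rightarrow> real \<Rightarrow> real \<Rightarrow> real^'n \<Rightarrow> real^'n \<Rightarrow> nat \<Rightarrow> real^'n" where
  "hbgd f \<gamma> \<beta> x0 x1 0 = x0"
| "hbgd f \<gamma> \<beta> x0 x1 (Suc 0) = x1"
| "hbgd f \<gamma> \<beta> x0 x1 (Suc (Suc k)) =
     hbgd f \<gamma> \<beta> x0 x1 (Suc k) - \<gamma> *\<^sub>R gradient f (hbgd f \<gamma> \<beta> x0 x1 (Suc k))
     + \<beta> *\<^sub>R (hbgd f \<gamma> \<beta> x0 x1 (Suc k) - hbgd f \<gamma> \<beta> x0 x1 k)"

definition W_HBGD :: "(real^'n \<Rightarrow> real) \<Rightarrow> real \<Rightarrow> real \<Rightarrow> ((real^'n) \<times> (real^'n)) set" where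
  "W_HBGD f \<gamma> \<beta> = {(x0, x1). \<exists>l \<in> strict_saddles f. hbgd f \<gamma> \<beta> x0 x1 \<longlonglongrightarrow> l}"

end

theory Submission
  imports Defs
begin

text \<open>Write \<open>F\<close> for the map \<open>(x\<^sub>k\<^sub>-\<^sub>1, x\<^sub>k) \<mapsto> (x\<^sub>k, x\<^sub>k\<^sub>+\<^sub>1)\<close>. A sequence of iterates that converges to a
  strict saddle \<open>p\<close> is an orbit of \<open>F\<close> that converges to \<open>(p, p)\<close>; such an orbit eventually stays in
  any given ball around \<open>(p, p)\<close>. Since \<open>F\<close> has a differentiable inverse (as \<open>\<beta> \<noteq> 0\<close>) and countably
  many such balls cover all saddles, it suffices to find for each \<open>p\<close> one ball in which only a
  negligible set of points stays trapped under \<open>F\<close> (\<open>negligible_basin\<close>).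

  The local statement is usually derived from the centre-stable manifold theorem. Here it follows from
  a cone argument. Suppose that a quadratic form \<open>Q\<close>, positive somewhere, is expanded by the derivative
  \<open>A\<close> of \<open>F\<close> at \<open>(p, p)\<close>, in the sense that \<open>Q (A d) > m * Q d\<close> for some \<open>m > 1\<close> and all \<open>d \<noteq> 0\<close>.
  By strict differentiability, \<open>Q (F x - F y) \<ge> m * Q (x - y)\<close> for all \<open>x\<close>, \<open>y\<close> in a small ball. Two
  trapped points then satisfy \<open>Q (x - y) \<le> 0\<close>, for otherwise the values of \<open>Q\<close> along the two orbits
  would grow without bound. A set all of whose differences avoid an open cone is a Lipschitz graph
  over a subset of a hyperplane, and so it is negligible (\<open>negligible_locally_trapped_set\<close>).

  The form comes from physics. Let \<open>H\<close> be the Hessian at \<open>p\<close>. Substituting \<open>x\<^sub>k = \<rho>\<^sup>k y\<^sub>k\<close> with \<open>\<rho>\<close>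
  slightly larger than \<open>1\<close> turns the linearised recursion into a heavy-ball recursion for \<open>H + \<delta>\<close>,
  where \<open>\<delta> > 0\<close> is determined by \<open>\<rho>\<close> and tends to \<open>0\<close> as \<open>\<rho>\<close> tends to \<open>1\<close>. For \<open>\<rho>\<close> close to \<open>1\<close>,
  \<open>H + \<delta>\<close> is invertible and still has a negative eigenvalue, and the step size condition
  \<open>\<gamma> * L < 2 * (1 - \<beta>)\<close> persists for the rescaled recursion. That condition makes the total energy
  strictly decreasing away from equilibrium. The negative of the energy is the form \<open>Q\<close>, with
  \<open>m = \<rho>\<^sup>2\<close> (\<open>heavy_ball_form_growth\<close>, \<open>heavy_ball_expanded_form\<close>).\<close>

section \<open>Maps that expand an indefinite quadratic form\<close>

text \<open>A homogeneous function is determined by its values on the unit sphere, where a continuous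
  positive function on the compact set of directions in the cone has a positive minimum.\<close>

lemma homogeneous_lower_bound:
  fixes q :: "'a::euclidean_space \<Rightarrow> real"
  assumes "closed C" and cone: "\<And>t x. x \<in> C \<Longrightarrow> 0 < t \<Longrightarrow> t *\<^sub>R x \<in> C"
    and cont: "continuous_on UNIV q"
    and hom: "\<And>t x. 0 < t \<Longrightarrow> q (t *\<^sub>R x) = t ^ n * q x"
    and pos: "\<And>x. x \<in> C \<Longrightarrow> x \<noteq> 0 \<Longrightarrow> 0 < q x"
    and zero: "0 \<le> q 0"
  obtains c where "0 < c" "\<And>x. x \<in> C \<Longrightarrow> x \<noteq> 0 \<Longrightarrow> c * norm x ^ n \<le> q x"
proof -
  let ?K = "C \<inter> sphere 0 1"
  have scale: "(1 / norm x) *\<^sub>R x \<in> ?K" "q x = norm x ^ n * q ((1 / norm x) *\<^sub>R x)"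
    if "x \<in> C" "x \<noteq> 0" for x
  proof -
    show "(1 / norm x) *\<^sub>R x \<in> ?K" using that cone[of x "1 / norm x"] by simp
    have "q x = q (norm x *\<^sub>R ((1 / norm x) *\<^sub>R x))" using that by simp
    also have "\<dots> = norm x ^ n * q ((1 / norm x) *\<^sub>R x)" using that by (intro hom) simp
    finally show "q x = norm x ^ n * q ((1 / norm x) *\<^sub>R x)" .
  qed
  show thesis
  proof (cases "?K = {}")
    case True
    then show thesis using scale(1) that[of 1] by auto
  next
    case False
    have "compact ?K" using \<open>closed C\<close> by (simp add: closed_Int_compact)
    then obtain z where z: "z \<in> ?K" "\<And>y. y \<in> ?K \<Longrightarrow> q z \<le> q y"
      using continuous_attains_inf[OF _ False continuous_on_subset[OF cont subset_UNIV]] by blast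
    have "q z > 0" using z(1) by (intro pos) auto
    moreover have "q z * norm x ^ n \<le> q x" if "x \<in> C" "x \<noteq> 0" for x
    proof -
      have "norm x ^ n * q z \<le> norm x ^ n * q ((1 / norm x) *\<^sub>R x)"
        using scale(1)[OF that] z(2) by (intro mult_left_mono) auto
      then show ?thesis using scale(2)[OF that] by (simp add: mult.commute)
    qed
    ultimately show thesis using that by blast
  qed
qed

text \<open>No two points of \<open>S\<close> differ by a vector in the open cone \<open>B d d > 0\<close>, which contains the
  nonzero multiples of \<open>w\<close>. The orthogonal projection along \<open>w\<close> is therefore injective on \<open>S\<close>, and by
  homogeneity its inverse is even Lipschitz. So \<open>S\<close> is a Lipschitz image of a subset of the
  hyperplane orthogonal to \<open>w\<close>.\<close>

lemma negligible_if_differences_avoid_cone: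
  fixes B :: "'a::euclidean_space \<Rightarrow> 'a \<Rightarrow> real"
  assumes B: "bounded_bilinear B" and w: "B w w > 0"
    and S: "\<And>x y. x \<in> S \<Longrightarrow> y \<in> S \<Longrightarrow> B (x - y) (x - y) \<le> 0"
  shows "negligible S"
proof -
  interpret B: bounded_bilinear B by fact
  have w0: "w \<noteq> 0" using w B.zero_left by auto
  define \<pi> where "\<pi> x = x - (inner w x / inner w w) *\<^sub>R w" for x
  define C where "C = {d. B d d \<le> 0}"
  have \<pi>_lin: "\<pi> (x - y) = \<pi> x - \<pi> y" "\<pi> (t *\<^sub>R x) = t *\<^sub>R \<pi> x" for x y t
    by (simp_all add: \<pi>_def inner_diff_right algebra_simps diff_divide_distrib)
  have contB: "continuous_on UNIV (\<lambda>d. B d d)"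
    by (intro B.continuous_on continuous_on_id)
  have "closed C"
    unfolding C_def using continuous_on_closed_Collect_le[OF contB continuous_on_const closed_UNIV, of 0] by simp
  moreover have "t *\<^sub>R x \<in> C" if "x \<in> C" "0 < t" for t x
    using that by (simp add: C_def B.scaleR_left B.scaleR_right mult_nonneg_nonpos)
  moreover have "continuous_on UNIV (\<lambda>x. norm (\<pi> x))"
    unfolding \<pi>_def using w0 by (intro continuous_intros) auto
  moreover have "norm (\<pi> (t *\<^sub>R x)) = t ^ 1 * norm (\<pi> x)" if "0 < t" for t x
    using that by (simp add: \<pi>_lin)
  moreover have "0 < norm (\<pi> x)" if "x \<in> C" "x \<noteq> 0" for x
  proof (rule ccontr)
    assume "\<not> 0 < norm (\<pi> x)"
    then obtain t where t: "x = t *\<^sub>R w" by (auto simp: \<pi>_def)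
    then have "t\<^sup>2 * B w w \<le> 0"
      using that(1) by (simp add: C_def B.scaleR_left B.scaleR_right power2_eq_square)
    moreover have "t\<^sup>2 * B w w > 0" using that(2) t w by simp
    ultimately show False by simp
  qed
  ultimately obtain c where c: "0 < c" "\<And>x. x \<in> C \<Longrightarrow> x \<noteq> 0 \<Longrightarrow> c * norm x ^ 1 \<le> norm (\<pi> x)"
    using homogeneous_lower_bound[of C "\<lambda>x. norm (\<pi> x)" 1] norm_ge_zero by blast
  have lip: "norm (x - y) \<le> (1 / c) * norm (\<pi> x - \<pi> y)" if "x \<in> S" "y \<in> S" for x y
  proof (cases "x = y")
    case False
    have "c * norm (x - y) \<le> norm (\<pi> (x - y))"
      using c(2)[of "x - y"] S[OF that] False by (simp add: C_def)
    then show ?thesis using c(1) by (simp add: \<pi>_lin field_simps)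
  qed simp
  define g where "g = inv_into S \<pi>"
  have inj: "inj_on \<pi> S"
    using lip by (force intro: inj_onI)
  have g: "g (\<pi> x) = x" if "x \<in> S" for x using that inj by (simp add: g_def)
  have "\<pi> ` S \<subseteq> {x. inner w x = 0}"
    using w0 by (auto simp: \<pi>_def inner_diff_right)
  then have "negligible (\<pi> ` S)"
    using negligible_hyperplane[of w 0] w0 negligible_subset by blast
  then have "negligible (g ` \<pi> ` S)"
  proof (rule negligible_locally_Lipschitz_image[OF order_refl])
    fix x assume "x \<in> \<pi> ` S"
    then have "\<forall>y\<in>\<pi> ` S \<inter> UNIV. norm (g y - g x) \<le> (1 / c) * norm (y - x)"
      using lip by (auto simp: g)
    then show "\<exists>T b. open T \<and> x \<in> T \<and> (\<forall>y\<in>\<pi> ` S \<inter> T. norm (g y - g x) \<le> b * norm (y - x))"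
      by (intro exI[of _ UNIV] exI[of _ "1 / c"]) auto
  qed
  moreover have "g ` \<pi> ` S = S" using g by (force simp: image_image)
  ultimately show ?thesis by simp
qed

text \<open>If the difference of two orbits that stay in \<open>U\<close> ever has a positive value under the form, this
  value grows at least like \<open>m ^ k\<close>, which is impossible in a bounded set. Hence differences of
  trapped points avoid the cone. This takes the place of the local centre-stable manifold theorem:
  the trapped set is shown to lie in a Lipschitz graph, without constructing an invariant manifold.\<close>

lemma negligible_trapped_set:
  fixes B :: "'a::euclidean_space \<Rightarrow> 'a \<Rightarrow> real"
  assumes B: "bounded_bilinear B" and w: "B w w > 0" and "bounded U" and m: "m > 1"
    and expand: "\<And>x y. x \<in> U \<Longrightarrow> y \<in> U \<Longrightarrow> m * B (x - y) (x - y) \<le> B (F x - F y) (F x - F y)"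
  shows "negligible {z. \<forall>k. (F ^^ k) z \<in> U}" (is "negligible ?S")
proof (rule negligible_if_differences_avoid_cone[OF B w])
  interpret B: bounded_bilinear B by fact
  fix x y assume xy: "x \<in> ?S" "y \<in> ?S"
  define q where "q k = B ((F ^^ k) x - (F ^^ k) y) ((F ^^ k) x - (F ^^ k) y)" for k
  have grow: "m ^ k * q 0 \<le> q k" for k
  proof (induction k)
    case (Suc k)
    have "m * (m ^ k * q 0) \<le> m * q k" using Suc m by (intro mult_left_mono) auto
    also have "\<dots> \<le> q (Suc k)" using expand xy by (simp add: q_def)
    finally show ?case by simp
  qed simp
  obtain R where R: "\<And>z. z \<in> U \<Longrightarrow> norm z \<le> R" using \<open>bounded U\<close> bounded_iff by blast
  obtain K where K: "K > 0" "\<And>a b. norm (B a b) \<le> norm a * norm b * K"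
    using B.pos_bounded by blast
  have bound: "q k \<le> (2 * R) * (2 * R) * K" for k
  proof -
    let ?d = "(F ^^ k) x - (F ^^ k) y"
    have d: "norm ?d \<le> 2 * R"
      using norm_triangle_ineq4[of "(F ^^ k) x" "(F ^^ k) y"] R[of "(F ^^ k) x"] R[of "(F ^^ k) y"] xy by auto
    have "q k \<le> norm ?d * norm ?d * K" using K(2)[of ?d ?d] by (simp add: q_def)
    also have "\<dots> \<le> (2 * R) * (2 * R) * K"
      using d K(1) order_trans[OF norm_ge_zero d] by (intro mult_right_mono mult_mono) auto
    finally show ?thesis .
  qed
  show "B (x - y) (x - y) \<le> 0"
  proof (rule ccontr)
    assume "\<not> ?thesis"
    then have q0: "q 0 > 0" by (simp add: q_def)
    obtain k where "(2 * R) * (2 * R) * K / q 0 < m ^ k" using real_arch_pow[OF m] by blast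
    then have "(2 * R) * (2 * R) * K < m ^ k * q 0" using q0 by (simp add: field_simps)
    then show False using grow[of k] bound[of k] by linarith
  qed
qed

text \<open>Strict expansion by a linear map has a margin proportional to the squared norm, which
  absorbs a relative error of small size.\<close>

lemma quadratic_expansion_stable:
  fixes B :: "'a::euclidean_space \<Rightarrow> 'a \<Rightarrow> real"
  assumes B: "bounded_bilinear B" and A: "linear A"
    and strict: "\<And>d. d \<noteq> 0 \<Longrightarrow> m * B d d < B (A d) (A d)"
  obtains \<epsilon> where "\<epsilon> > 0"
    "\<And>d e. norm e \<le> \<epsilon> * norm d \<Longrightarrow> m * B d d \<le> B (A d + e) (A d + e)"
proof -
  interpret B: bounded_bilinear B by fact
  have bA: "bounded_linear A" using A by (simp add: linear_conv_bounded_linear)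
  interpret A: bounded_linear A by fact
  have "continuous_on UNIV (\<lambda>d. B (A d) (A d) - m * B d d)"
    by (intro continuous_intros B.continuous_on A.continuous_on)
  moreover have "B (A (t *\<^sub>R x)) (A (t *\<^sub>R x)) - m * B (t *\<^sub>R x) (t *\<^sub>R x)
      = t ^ 2 * (B (A x) (A x) - m * B x x)" for t x
    by (simp add: A.scaleR B.scaleR_left B.scaleR_right power2_eq_square algebra_simps)
  moreover have "0 \<le> B (A 0) (A 0) - m * B 0 0" by (simp add: A.zero B.zero_left)
  moreover have "0 < B (A d) (A d) - m * B d d" if "d \<noteq> 0" for d
    using strict[OF that] by simp
  ultimately obtain c where c: "0 < c"
    "\<And>d. d \<noteq> 0 \<Longrightarrow> c * norm d ^ 2 \<le> B (A d) (A d) - m * B d d"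
    by (rule_tac homogeneous_lower_bound[of UNIV "\<lambda>d. B (A d) (A d) - m * B d d" 2]) auto
  obtain K where K: "K > 0" "\<And>a b. norm (B a b) \<le> norm a * norm b * K"
    using B.pos_bounded by blast
  obtain M where M: "M > 0" "\<And>d. norm (A d) \<le> norm d * M" using A.pos_bounded by blast
  \<comment> \<open>The error terms \<open>B (A d) e + B e (A d) + B e e\<close> are at most
    \<open>(2 * M * \<epsilon> + \<epsilon>\<^sup>2) * K * norm d ^ 2\<close>, and \<open>\<epsilon>\<^sup>2 \<le> \<epsilon>\<close>.\<close>
  define \<epsilon> where "\<epsilon> = min 1 (c / ((2 * M + 1) * K))"
  have \<epsilon>: "0 < \<epsilon>" "\<epsilon> \<le> 1" "\<epsilon> * ((2 * M + 1) * K) \<le> c"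
  proof -
    have p: "(2 * M + 1) * K > 0" using M(1) K(1) by simp
    show "0 < \<epsilon>" "\<epsilon> \<le> 1" using p c(1) by (simp_all add: \<epsilon>_def)
    have "\<epsilon> \<le> c / ((2 * M + 1) * K)" by (simp add: \<epsilon>_def)
    then show "\<epsilon> * ((2 * M + 1) * K) \<le> c" using p by (simp only: pos_le_divide_eq)
  qed
  have "m * B d d \<le> B (A d + e) (A d + e)" if e: "norm e \<le> \<epsilon> * norm d" for d e
  proof (cases "d = 0")
    case True
    then show ?thesis using e by (simp add: A.zero B.zero_left)
  next
    case False
    have "\<bar>B (A d) e\<bar> \<le> norm (A d) * norm e * K" "\<bar>B e (A d)\<bar> \<le> norm (A d) * norm e * K"
      using K(2)[of "A d" e] K(2)[of e "A d"] by (simp_all add: mult_ac)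
    moreover have "norm (A d) * norm e * K \<le> (norm d * M) * (\<epsilon> * norm d) * K"
      using M K e \<epsilon> by (intro mult_right_mono mult_mono) auto
    moreover have "\<bar>B e e\<bar> \<le> norm e * norm e * K" using K(2)[of e e] by simp
    moreover have "norm e * norm e * K \<le> (\<epsilon> * norm d) * (1 * norm d) * K"
      using e \<epsilon> K(1) mult_right_mono[OF \<epsilon>(2), of "norm d"]
      by (intro mult_right_mono mult_mono) auto
    moreover have "2 * ((norm d * M) * (\<epsilon> * norm d) * K) + (\<epsilon> * norm d) * (1 * norm d) * K
        = (\<epsilon> * ((2 * M + 1) * K)) * norm d ^ 2"
      by (simp add: power2_eq_square algebra_simps)
    moreover have "\<dots> \<le> c * norm d ^ 2" using \<epsilon>(3) by (intro mult_right_mono) auto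
    moreover have "B (A d + e) (A d + e) = B (A d) (A d) + B (A d) e + B e (A d) + B e e"
      by (simp add: B.add_left B.add_right)
    ultimately show ?thesis using c(2)[OF False] by linarith
  qed
  then show thesis using \<epsilon>(1) that by blast
qed

text \<open>The assumption on \<open>F\<close> is strict differentiability at \<open>p\<close> with derivative \<open>A\<close>: it compares
  two arbitrary points near \<open>p\<close>, because the expansion is needed for differences of orbits.\<close>

lemma negligible_locally_trapped_set:
  fixes B :: "'a::euclidean_space \<Rightarrow> 'a \<Rightarrow> real"
  assumes B: "bounded_bilinear B" and w: "B w w > 0" and A: "linear A" and m: "m > 1"
    and strict: "\<And>d. d \<noteq> 0 \<Longrightarrow> m * B d d < B (A d) (A d)"
    and deriv: "\<And>e. e > 0 \<Longrightarrow> \<exists>r>0. \<forall>x\<in>ball p r. \<forall>y\<in>ball p r.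
                  norm (F x - F y - A (x - y)) \<le> e * norm (x - y)"
  shows "\<exists>r>0. negligible {z. \<forall>k. (F ^^ k) z \<in> ball p r}"
proof -
  obtain e where e: "e > 0"
    "\<And>d h. norm h \<le> e * norm d \<Longrightarrow> m * B d d \<le> B (A d + h) (A d + h)"
    using quadratic_expansion_stable[OF B A strict] by blast
  obtain r where r: "r > 0"
    "\<And>x y. x \<in> ball p r \<Longrightarrow> y \<in> ball p r \<Longrightarrow> norm (F x - F y - A (x - y)) \<le> e * norm (x - y)"
    using deriv[OF e(1)] by blast
  have "negligible {z. \<forall>k. (F ^^ k) z \<in> ball p r}"
  proof (rule negligible_trapped_set[OF B w bounded_ball m])
    fix x y assume "x \<in> ball p r" "y \<in> ball p r"
    from e(2)[OF r(2)[OF this]]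
    show "m * B (x - y) (x - y) \<le> B (F x - F y) (F x - F y)" by simp
  qed
  then show ?thesis using r(1) by blast
qed

text \<open>The tail of a convergent orbit is trapped near the limit. Countably many of the neighbourhoods
  suffice by the Lindelof property, so the basin is a countable union of iterated preimages of
  negligible sets, and these preimages are images under powers of the differentiable map \<open>G\<close>.\<close>

lemma negligible_basin:
  fixes F G :: "'a::euclidean_space \<Rightarrow> 'a"
  assumes GF: "\<And>z. G (F z) = z" and G: "G differentiable_on UNIV"
    and local: "\<And>p. p \<in> X \<Longrightarrow> \<exists>r>0. negligible {z. \<forall>k. (F ^^ k) z \<in> ball p r}"
  shows "negligible {z. \<exists>p\<in>X. (\<lambda>k. (F ^^ k) z) \<longlonglongrightarrow> p}"
proof -
  define T where "T V = {z. \<forall>k. (F ^^ k) z \<in> V}" for V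
  define \<V> where "\<V> = {V. open V \<and> negligible (T V)}"
  obtain \<W> where \<W>: "\<W> \<subseteq> \<V>" "countable \<W>" "\<Union>\<W> = \<Union>\<V>"
    using Lindelof[of \<V>] by (auto simp: \<V>_def)
  have neg: "negligible ((G ^^ n) ` S)" if "negligible S" for n S
  proof (induction n)
    case (Suc n)
    have "negligible (G ` (G ^^ n) ` S)"
      using G by (intro negligible_differentiable_image_negligible Suc differentiable_on_subset[OF G]) auto
    then show ?case by (simp add: image_comp)
  qed (simp add: that)
  have GFn: "(G ^^ n) ((F ^^ n) z) = z" for n z
    by (induction n arbitrary: z) (simp_all add: funpow_swap1 GF)
  have "{z. \<exists>p\<in>X. (\<lambda>k. (F ^^ k) z) \<longlonglongrightarrow> p} \<subseteq> (\<Union>V\<in>\<W>. \<Union>n. (G ^^ n) ` T V)"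
  proof safe
    fix z p assume "p \<in> X" and lim: "(\<lambda>k. (F ^^ k) z) \<longlonglongrightarrow> p"
    then obtain r where "r > 0" "negligible (T (ball p r))" using local[OF \<open>p \<in> X\<close>] unfolding T_def by blast
    then have "p \<in> \<Union>\<V>" unfolding \<V>_def by (metis (mono_tags) UnionI centre_in_ball mem_Collect_eq open_ball)
    then obtain V where V: "V \<in> \<W>" "p \<in> V" using \<W>(3) by blast
    then have "open V" using \<W>(1) by (auto simp: \<V>_def)
    then obtain n where n: "\<And>k. k \<ge> n \<Longrightarrow> (F ^^ k) z \<in> V"
      using topological_tendstoD[OF lim _ V(2)] by (auto simp: eventually_sequentially)
    have "(F ^^ k) ((F ^^ n) z) \<in> V" for k
      using n[of "k + n"] by (simp add: funpow_add)
    then have "(F ^^ n) z \<in> T V" by (simp add: T_def)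
    then have "z \<in> (G ^^ n) ` T V" using GFn[of n z] image_eqI[of z "G ^^ n" "(F ^^ n) z" "T V"] by simp
    then show "z \<in> (\<Union>V\<in>\<W>. \<Union>n. (G ^^ n) ` T V)" using V(1) by blast
  qed
  moreover have "negligible (\<Union>V\<in>\<W>. \<Union>n. (G ^^ n) ` T V)"
    using \<W>(1,2) neg by (intro negligible_countable_Union countable_image) (auto simp: \<V>_def intro!: negligible_Union_nat)
  ultimately show ?thesis using negligible_subset by blast
qed

section \<open>Second derivatives and self-adjoint operators\<close>

text \<open>Schwarz's theorem for a function whose gradient \<open>g\<close> is differentiable at the single point \<open>p\<close>.
  The second difference of \<open>f\<close> over the parallelogram spanned by \<open>t *\<^sub>R u\<close> and \<open>t *\<^sub>R v\<close> is
  symmetric in \<open>u\<close> and \<open>v\<close>; the mean value theorem, applied along either side, shows that it is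
  \<open>t\<^sup>2 * (u \<bullet> D v)\<close> as well as \<open>t\<^sup>2 * (v \<bullet> D u)\<close> up to \<open>o(t\<^sup>2)\<close>.\<close>

lemma second_derivative_symmetric:
  fixes f :: "'a::real_inner \<Rightarrow> real"
  assumes f: "\<And>x. (f has_derivative (\<lambda>h. h \<bullet> g x)) (at x)"
    and g: "(g has_derivative D) (at p)"
  shows "u \<bullet> D v = v \<bullet> D u"
proof -
  interpret D: bounded_linear D using g has_derivative_bounded_linear by blast
  define N where "N = norm u + norm v + 1"
  have N: "N > 0" "norm u \<le> N" "norm v \<le> N"
    by (simp_all add: N_def add_nonneg_pos)
  define \<Delta> where "\<Delta> t = f (p + t *\<^sub>R u + t *\<^sub>R v) - f (p + t *\<^sub>R u) - f (p + t *\<^sub>R v) + f p" for t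
  have main: "\<exists>t>0. \<bar>\<Delta> t - t\<^sup>2 * (u \<bullet> D v)\<bar> \<le> 2 * e * N\<^sup>2 * t\<^sup>2 \<and> \<bar>\<Delta> t - t\<^sup>2 * (v \<bullet> D u)\<bar> \<le> 2 * e * N\<^sup>2 * t\<^sup>2"
    if "e > 0" for e
  proof -
    obtain d where d: "d > 0" "\<And>y. norm (y - p) < d \<Longrightarrow> norm (g y - g p - D (y - p)) \<le> e * norm (y - p)"
      using g \<open>e > 0\<close> unfolding has_derivative_at_alt by blast
    define t where "t = d / (2 * N)"
    have t: "t > 0" "t * N < d" using d(1) N(1) by (simp_all add: t_def field_simps)
    have est: "\<bar>f (p + t *\<^sub>R a + t *\<^sub>R b) - f (p + t *\<^sub>R a) - f (p + t *\<^sub>R b) + f p - t\<^sup>2 * (a \<bullet> D b)\<bar> \<le> 2 * e * N\<^sup>2 * t\<^sup>2"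
      if ab: "norm a + norm b \<le> N" for a b
    proof -
      define \<phi> where "\<phi> s = f (p + s *\<^sub>R a + t *\<^sub>R b) - f (p + s *\<^sub>R a)" for s
      have "(\<phi> has_real_derivative a \<bullet> (g (p + s *\<^sub>R a + t *\<^sub>R b) - g (p + s *\<^sub>R a))) (at s)" for s
        unfolding \<phi>_def has_field_derivative_def
        by (rule derivative_eq_intros has_derivative_compose[OF _ f] refl)+
           (auto simp: inner_diff_right algebra_simps)
      then obtain s where s: "0 < s" "s < t"
        "\<phi> t - \<phi> 0 = (t - 0) * (a \<bullet> (g (p + s *\<^sub>R a + t *\<^sub>R b) - g (p + s *\<^sub>R a)))"
        using MVT2[OF t(1), of \<phi> "\<lambda>s. a \<bullet> (g (p + s *\<^sub>R a + t *\<^sub>R b) - g (p + s *\<^sub>R a))"] by blast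
      have near: "norm (g (p + y) - g p - D y) \<le> e * (t * N)" if "norm y \<le> t * N" for y
      proof -
        have "norm (g (p + y) - g p - D y) \<le> e * norm y" using d(2)[of "p + y"] that t(2) by simp
        also have "\<dots> \<le> e * (t * N)" using that \<open>e > 0\<close> by (intro mult_left_mono) auto
        finally show ?thesis .
      qed
      have "norm (s *\<^sub>R a + t *\<^sub>R b) \<le> s * norm a + t * norm b"
        using norm_triangle_ineq[of "s *\<^sub>R a" "t *\<^sub>R b"] s t by simp
      also have "\<dots> \<le> t * norm a + t * norm b" using s by (simp add: mult_right_mono)
      also have "\<dots> = t * (norm a + norm b)" by (simp add: distrib_left)
      also have "\<dots> \<le> t * N" using ab t by (intro mult_left_mono) auto
      finally have n1: "norm (s *\<^sub>R a + t *\<^sub>R b) \<le> t * N" .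
      have "norm (s *\<^sub>R a) \<le> t * norm a" using s by (simp add: mult_right_mono)
      also have "\<dots> \<le> t * N" using ab t norm_ge_zero[of b] by (intro mult_left_mono) linarith+
      finally have n2: "norm (s *\<^sub>R a) \<le> t * N" .
      define r where "r = g (p + s *\<^sub>R a + t *\<^sub>R b) - g (p + s *\<^sub>R a) - t *\<^sub>R D b"
      have "r = (g (p + (s *\<^sub>R a + t *\<^sub>R b)) - g p - D (s *\<^sub>R a + t *\<^sub>R b)) - (g (p + s *\<^sub>R a) - g p - D (s *\<^sub>R a))"
        by (simp add: r_def D.add D.scaleR add.assoc)
      then have "norm r \<le> norm (g (p + (s *\<^sub>R a + t *\<^sub>R b)) - g p - D (s *\<^sub>R a + t *\<^sub>R b))
          + norm (g (p + s *\<^sub>R a) - g p - D (s *\<^sub>R a))"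
        by (simp only: norm_triangle_ineq4)
      then have "norm r \<le> e * (t * N) + e * (t * N)"
        using near[OF n1] near[OF n2] by linarith
      moreover have "norm a \<le> N" using ab norm_ge_zero[of b] by linarith
      ultimately have "norm a * norm r \<le> N * (e * (t * N) + e * (t * N))"
        using N(1) by (intro mult_mono) auto
      then have "t * \<bar>a \<bullet> r\<bar> \<le> t * (N * (e * (t * N) + e * (t * N)))"
        using t Cauchy_Schwarz_ineq2[of a r] by (intro mult_left_mono) auto
      also have "\<dots> = 2 * e * N\<^sup>2 * t\<^sup>2" by (simp add: power2_eq_square algebra_simps)
      finally have "\<bar>t * (a \<bullet> r)\<bar> \<le> 2 * e * N\<^sup>2 * t\<^sup>2" using t by (simp add: abs_mult)
      moreover have "f (p + t *\<^sub>R a + t *\<^sub>R b) - f (p + t *\<^sub>R a) - f (p + t *\<^sub>R b) + f p - t\<^sup>2 * (a \<bullet> D b) = t * (a \<bullet> r)"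
        using s(3) by (simp add: \<phi>_def r_def inner_diff_right power2_eq_square algebra_simps)
      ultimately show ?thesis by simp
    qed
    have "\<Delta> t = f (p + t *\<^sub>R v + t *\<^sub>R u) - f (p + t *\<^sub>R v) - f (p + t *\<^sub>R u) + f p"
      by (simp add: \<Delta>_def add_ac)
    then show ?thesis
      using est[of u v] est[of v u] t(1) unfolding \<Delta>_def by (auto simp: N_def intro!: exI[of _ t])
  qed
  have "\<bar>u \<bullet> D v - v \<bullet> D u\<bar> \<le> e" if "e > 0" for e
  proof -
    define e' where "e' = e / (4 * N\<^sup>2)"
    have "e' > 0" using that N by (simp add: e'_def)
    from main[OF this] obtain t where t: "t > 0"
      "\<bar>\<Delta> t - t\<^sup>2 * (u \<bullet> D v)\<bar> \<le> 2 * e' * N\<^sup>2 * t\<^sup>2" "\<bar>\<Delta> t - t\<^sup>2 * (v \<bullet> D u)\<bar> \<le> 2 * e' * N\<^sup>2 * t\<^sup>2"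
      by blast
    have "2 * e' * N\<^sup>2 * t\<^sup>2 + 2 * e' * N\<^sup>2 * t\<^sup>2 = t\<^sup>2 * e" using N(1) by (simp add: e'_def field_simps)
    then have "\<bar>t\<^sup>2 * (u \<bullet> D v) - t\<^sup>2 * (v \<bullet> D u)\<bar> \<le> t\<^sup>2 * e" using t(2,3) by linarith
    then have "t\<^sup>2 * \<bar>u \<bullet> D v - v \<bullet> D u\<bar> \<le> t\<^sup>2 * e"
      by (simp add: abs_mult flip: right_diff_distrib)
    then show ?thesis using t(1) by simp
  qed
  then show ?thesis using field_le_epsilon[of "\<bar>u \<bullet> D v - v \<bullet> D u\<bar>" 0] by simp
qed

text \<open>A minimiser \<open>x\<close> of the Rayleigh quotient is an eigenvector: with \<open>l\<close> the minimum, the form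
  \<open>P y = y \<bullet> T y - l * (y \<bullet> y)\<close> is nonnegative and vanishes at \<open>x\<close>, and moving from \<open>x\<close> against
  the residual \<open>r = T x - l *\<^sub>R x\<close> would make it negative unless \<open>r = 0\<close>.\<close>

lemma self_adjoint_has_eigenvector:
  fixes T :: "'a::euclidean_space \<Rightarrow> 'a"
  assumes T: "linear T" and sa: "\<And>x y. x \<bullet> T y = y \<bullet> T x"
  obtains l v where "v \<noteq> 0" "T v = l *\<^sub>R v"
proof -
  interpret T: bounded_linear T using T by (simp add: linear_conv_bounded_linear)
  have ne: "sphere (0::'a) 1 \<noteq> {}" by simp
  have "continuous_on (sphere 0 1) (\<lambda>x. x \<bullet> T x)"
    by (intro continuous_intros T.continuous_on)
  then obtain x where x: "norm x = 1" "\<And>y. norm y = 1 \<Longrightarrow> x \<bullet> T x \<le> y \<bullet> T y"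
    using continuous_attains_inf[OF compact_sphere ne] by (auto simp: sphere_def)
  define l where "l = x \<bullet> T x"
  define P where "P y = y \<bullet> T y - l * (y \<bullet> y)" for y
  have P: "0 \<le> P y" for y
  proof (cases "y = 0")
    case False
    let ?z = "(1 / norm y) *\<^sub>R y"
    have "l \<le> ?z \<bullet> T ?z" unfolding l_def using False by (intro x(2)) simp
    then have "l * (norm y)\<^sup>2 \<le> y \<bullet> T y"
      using False by (simp add: T.scaleR field_simps power2_eq_square)
    then show ?thesis by (simp add: P_def power2_norm_eq_inner)
  qed (simp add: P_def)
  define r where "r = T x - l *\<^sub>R x"
  have xx: "x \<bullet> x = 1" using x(1) by (simp add: norm_eq_1)
  have ineq: "2 * (r \<bullet> r) \<le> s * P r" if "s > 0" for s
  proof -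
    have "P (x - s *\<^sub>R r) = P x - 2 * s * (r \<bullet> T x - l * (r \<bullet> x)) + s\<^sup>2 * P r"
      using sa[of x r] by (simp add: P_def T.diff T.scaleR inner_diff_left inner_diff_right inner_commute
         power2_eq_square algebra_simps)
    moreover have "r \<bullet> T x - l * (r \<bullet> x) = r \<bullet> r" by (simp add: r_def inner_diff_right)
    moreover have "P x = 0" by (simp add: P_def l_def xx)
    ultimately have "s * (2 * (r \<bullet> r)) \<le> s * (s * P r)"
      using P[of "x - s *\<^sub>R r"] by (simp add: power2_eq_square algebra_simps)
    then show ?thesis using that by simp
  qed
  have "r = 0"
  proof (rule ccontr)
    assume "r \<noteq> 0"
    then have rr: "r \<bullet> r > 0" by simp
    then have "P r > 0" using ineq[of 1] by linarith
    then show False using ineq[of "r \<bullet> r / P r"] rr by simp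
  qed
  then have "T x = l *\<^sub>R x" by (simp add: r_def)
  then show thesis using that[of x l] x(1) by force
qed

text \<open>Eigenvectors for different eigenvalues are orthogonal, hence independent.\<close>

lemma self_adjoint_finite_eigenvalues:
  fixes T :: "'a::euclidean_space \<Rightarrow> 'a"
  assumes sa: "\<And>x y. x \<bullet> T y = y \<bullet> T x"
  shows "finite {l. \<exists>v. v \<noteq> 0 \<and> T v = l *\<^sub>R v}" (is "finite ?E")
proof -
  obtain e where e: "\<And>l. l \<in> ?E \<Longrightarrow> e l \<noteq> 0 \<and> T (e l) = l *\<^sub>R e l"
    using bchoice[of ?E "\<lambda>l v. v \<noteq> 0 \<and> T v = l *\<^sub>R v"] by auto
  have orth: "e l \<bullet> e k = 0" if "l \<in> ?E" "k \<in> ?E" "l \<noteq> k" for l k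
    using sa[of "e l" "e k"] e[OF that(1)] e[OF that(2)] that(3) by (simp add: inner_commute)
  have "inj_on e ?E"
    using orth e by (metis (no_types, lifting) inj_onI inner_eq_zero_iff)
  moreover have "independent (e ` ?E)"
  proof (rule pairwise_orthogonal_independent)
    show "pairwise orthogonal (e ` ?E)"
      using orth by (force simp: pairwise_def orthogonal_def)
    show "0 \<notin> e ` ?E" using e by (metis (no_types, lifting) imageE)
  qed
  ultimately show ?thesis using independent_imp_finite finite_imageD by blast
qed

text \<open>Near \<open>p\<close> the function \<open>g - J p\<close> has a derivative of small norm, so the mean value inequality
  gives it a small Lipschitz constant.\<close>

lemma C1_strictly_differentiable:
  fixes g :: "real^'n \<Rightarrow> real^'m" and J :: "real^'n \<Rightarrow> real^'n^'m"
  assumes g: "\<And>x. (g has_derivative (*v) (J x)) (at x)" and J: "continuous_on UNIV J" and "e > 0"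
  obtains r where "r > 0"
    "\<And>x y. x \<in> ball p r \<Longrightarrow> y \<in> ball p r \<Longrightarrow> norm (g x - g y - J p *v (x - y)) \<le> e * norm (x - y)"
proof -
  define s where "s x = (\<Sum>i\<in>UNIV. \<Sum>j\<in>UNIV. \<bar>(J x - J p) $ i $ j\<bar>)" for x
  have "isCont J p" using J by (simp add: continuous_on_eq_continuous_at)
  then have "isCont s p" unfolding s_def by (intro continuous_intros)
  then obtain r where r: "r > 0" "\<And>x. dist x p < r \<Longrightarrow> dist (s x) (s p) < e"
    using \<open>e > 0\<close> unfolding continuous_at_eps_delta by blast
  have "s p = 0" by (simp add: s_def)
  then have small: "s x \<le> e" if "dist x p < r" for x
    using r(2)[OF that] by simp
  have "norm (g x - g y - J p *v (x - y)) \<le> e * norm (x - y)" if "x \<in> ball p r" "y \<in> ball p r" for x y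
  proof -
    have "norm (g x - g y - J p *v (x - y)) \<le> norm (x - y) * e"
    proof (rule differentiable_bound_linearization[where S = "ball p r" and f' = "\<lambda>x. (*v) (J x)"])
      show "y + t *\<^sub>R (x - y) \<in> ball p r" if "t \<in> {0..1}" for t
        using convexD_alt[OF convex_ball \<open>y \<in> ball p r\<close> \<open>x \<in> ball p r\<close>, of t] that
        by (simp add: algebra_simps)
      show "(g has_derivative (*v) (J x)) (at x within ball p r)" for x
        using g has_derivative_at_withinI by blast
      show "onorm ((*v) (J x) - (*v) (J p)) \<le> e" if "x \<in> ball p r" for x
      proof -
        have "(*v) (J x) - (*v) (J p) = (*v) (J x - J p)"
          by (simp add: fun_eq_iff matrix_vector_mult_diff_rdistrib)
        then show ?thesis
          using onorm_le_matrix_component_sum[of "J x - J p"] small[of x] that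
          by (simp add: s_def dist_commute)
      qed
    qed (use r(1) in auto)
    then show ?thesis by (simp add: mult.commute)
  qed
  then show thesis using that r(1) by blast
qed

lemma C2_gradient:
  fixes f :: "real^'n \<Rightarrow> real"
  assumes "C2 f"
  shows "(f has_derivative (\<lambda>h. h \<bullet> gradient f x)) (at x)"
proof -
  define D where "D = frechet_derivative f (at x)"
  have D: "(f has_derivative D) (at x)"
    using assms by (simp add: C2_def D_def frechet_derivative_works[symmetric])
  have "D h = h \<bullet> adjoint D 1" for h
    using adjoint_works[OF has_derivative_linear[OF D], of h 1] by simp
  then have "D = (\<lambda>h. h \<bullet> adjoint D 1)" by (rule ext)
  then have ex: "GDERIV f x :> adjoint D 1" using D unfolding gderiv_def by metis
  have "GDERIV f x :> gradient f x"
    unfolding gradient_def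
  proof (rule theI[of "\<lambda>d. GDERIV f x :> d", OF ex])
    fix d assume "GDERIV f x :> d"
    then have "(\<lambda>h. h \<bullet> d) = (\<lambda>h. h \<bullet> adjoint D 1)"
      using ex has_derivative_unique unfolding gderiv_def by blast
    then show "d = adjoint D 1" by (metis vector_eq_ldot)
  qed
  then show ?thesis by (simp add: gderiv_def)
qed

lemma C2_hessian:
  assumes "C2 f"
  shows "(gradient f has_derivative (*v) (hessian f x)) (at x)"
proof -
  have "gradient f differentiable (at x)" using assms by (simp add: C2_def)
  then show ?thesis unfolding jacobian_works by (simp only: jacobian_def hessian_def)
qed

lemma C2_hessian_symmetric:
  assumes "C2 f"
  shows "u \<bullet> (hessian f x *v v) = v \<bullet> (hessian f x *v u)"
  using second_derivative_symmetric[OF C2_gradient[OF assms] C2_hessian[OF assms]] .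

section \<open>The linear heavy-ball recursion\<close>

text \<open>The rate \<open>\<rho>\<close> is a root of the characteristic equation
  \<open>\<rho>\<^sup>2 - (1 + \<beta> + \<gamma> * \<delta>) * \<rho> + \<beta> = 0\<close> of the linear recursion in a direction where
  \<open>T\<close> acts as \<open>-\<delta>\<close>, which is what the assumption on \<open>\<delta>\<close> says. Substituting \<open>x\<^sub>k = \<rho>\<^sup>k y\<^sub>k\<close> turns the heavy-ball recursion for
  \<open>T\<close> into one for \<open>K = T + \<delta>\<close> with momentum \<open>\<beta> / \<rho>\<^sup>2\<close> and step \<open>\<gamma> / \<rho>\<close>. For small step sizes
  a heavy-ball recursion dissipates its total (potential plus kinetic) energy, here proportional to
  \<open>\<gamma> * \<rho> * (b \<bullet> K b) + \<beta> * (U \<bullet> U)\<close>. The second identity is the balance of energy in the original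
  variables, where the substitution shows as the factor \<open>\<rho>\<^sup>2\<close>.\<close>

lemma heavy_ball_form_growth:
  fixes T :: "'a::real_inner \<Rightarrow> 'a" and a b :: 'a and \<rho> \<delta> \<beta> \<gamma> :: real
  assumes T: "linear T" and sa: "\<And>x y. x \<bullet> T y = y \<bullet> T x"
    and \<rho>: "\<rho> \<noteq> 0" and \<delta>: "\<gamma> * \<rho> * \<delta> = (\<rho> - 1) * (\<rho> - \<beta>)"
  defines "K \<equiv> \<lambda>x. T x + \<delta> *\<^sub>R x"
  defines "U \<equiv> b - \<rho> *\<^sub>R a"
  defines "b' \<equiv> b - \<gamma> *\<^sub>R T b + \<beta> *\<^sub>R (b - a)"
  defines "U' \<equiv> b' - \<rho> *\<^sub>R b"
  shows "\<rho> *\<^sub>R U' = \<beta> *\<^sub>R U - (\<rho> * \<gamma>) *\<^sub>R K b" (is ?step)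
    and "\<rho>\<^sup>2 * (\<gamma> * \<rho> * (b \<bullet> K b) + \<beta> * (U \<bullet> U)) - (\<gamma> * \<rho> * (b' \<bullet> K b') + \<beta> * (U' \<bullet> U'))
      = \<beta> * (norm (\<rho> *\<^sub>R U - U'))\<^sup>2 + 2 * (\<rho>\<^sup>2 - \<beta>) * (norm U')\<^sup>2 - \<gamma> * \<rho> * (U' \<bullet> K U')" (is ?growth)
proof -
  have "\<rho> *\<^sub>R U' - (\<beta> *\<^sub>R U - (\<rho> * \<gamma>) *\<^sub>R K b) = (\<gamma> * \<rho> * \<delta> - (\<rho> - 1) * (\<rho> - \<beta>)) *\<^sub>R b"
    by (simp add: U'_def U_def b'_def K_def algebra_simps)
  then show step: ?step using \<delta> by simp
  have b': "b' = \<rho> *\<^sub>R b + U'" by (simp add: U'_def)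
  have K: "K (x + y) = K x + K y" "K (c *\<^sub>R x) = c *\<^sub>R K x" "x \<bullet> K y = y \<bullet> K x" for x y c
    by (simp_all add: K_def linear_add[OF T] linear_scale[OF T] inner_add_right sa[of x y] inner_commute[of x y]
        algebra_simps)
  have e1: "b' \<bullet> K b' = \<rho>\<^sup>2 * (b \<bullet> K b) + 2 * \<rho> * (U' \<bullet> K b) + U' \<bullet> K U'"
    unfolding b' by (simp add: K(1,2) inner_add_left inner_add_right K(3)[of b U'] power2_eq_square algebra_simps)
  have "U' \<bullet> (\<rho> *\<^sub>R U') = U' \<bullet> (\<beta> *\<^sub>R U - (\<rho> * \<gamma>) *\<^sub>R K b)" using step by simp
  then have e2: "\<rho> * \<gamma> * (U' \<bullet> K b) = \<beta> * (U \<bullet> U') - \<rho> * (U' \<bullet> U')"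
    by (simp add: inner_diff_right inner_commute)
  have e3: "(norm (\<rho> *\<^sub>R U - U'))\<^sup>2 = \<rho>\<^sup>2 * (U \<bullet> U) - 2 * \<rho> * (U \<bullet> U') + U' \<bullet> U'"
    unfolding power2_norm_eq_inner
    by (simp add: inner_diff_left inner_diff_right inner_commute power2_eq_square algebra_simps)
  have "\<rho>\<^sup>2 * (\<gamma> * \<rho> * (b \<bullet> K b) + \<beta> * (U \<bullet> U)) - (\<gamma> * \<rho> * (b' \<bullet> K b') + \<beta> * (U' \<bullet> U'))
     = \<rho>\<^sup>2 * \<beta> * (U \<bullet> U) - 2 * \<rho> * (\<rho> * \<gamma> * (U' \<bullet> K b)) - \<gamma> * \<rho> * (U' \<bullet> K U') - \<beta> * (U' \<bullet> U')"
    unfolding e1 by (simp add: power2_eq_square algebra_simps)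
  also have "\<dots> = \<beta> * (norm (\<rho> *\<^sub>R U - U'))\<^sup>2 + 2 * (\<rho>\<^sup>2 - \<beta>) * (norm U')\<^sup>2 - \<gamma> * \<rho> * (U' \<bullet> K U')"
    unfolding e2 e3 power2_norm_eq_inner[of U'] by (simp add: power2_eq_square algebra_simps)
  finally show ?growth .
qed

text \<open>All requirements hold for \<open>\<rho>\<close> slightly above \<open>1\<close>: then \<open>\<delta>\<close> is small and positive, and the last
  inequality turns in the limit into the assumption \<open>\<gamma> * L < 2 * (1 - \<beta>)\<close>. The set \<open>E\<close> will be the spectrum; the
  requirement on it keeps \<open>-\<delta>\<close> strictly between the negative eigenvalues and \<open>0\<close>.\<close>

lemma heavy_ball_rate_exists:
  fixes \<beta> \<gamma> L :: real and E :: "real set"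
  assumes "finite E" "\<beta> < 1" "0 < \<gamma>" "\<gamma> * L < 2 * (1 - \<beta>)"
  obtains \<rho> \<delta> where "\<rho> > 1" "\<delta> > 0" "\<gamma> * \<rho> * \<delta> = (\<rho> - 1) * (\<rho> - \<beta>)"
    "\<forall>l\<in>E. l < 0 \<longrightarrow> \<delta> < - l" "\<gamma> * \<rho> * (L + \<delta>) < 2 * (\<rho>\<^sup>2 - \<beta>)"
proof -
  define d where "d \<rho> = (\<rho> - 1) * (\<rho> - \<beta>) / (\<gamma> * \<rho>)" for \<rho>
  have d0: "(d \<longlongrightarrow> (1 - 1) * (1 - \<beta>) / (\<gamma> * 1)) (at_right 1)"
    unfolding d_def using assms by (intro tendsto_intros) auto
  then have d: "(d \<longlongrightarrow> 0) (at_right 1)" by simp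
  have "\<forall>\<^sub>F \<rho> in at_right 1. \<forall>l\<in>E \<inter> {..<0}. d \<rho> < - l"
    using assms(1) order_tendstoD(2)[OF d] by (intro eventually_ball_finite) auto
  moreover have "\<forall>\<^sub>F \<rho> in at_right (1::real). 0 < 2 * (\<rho>\<^sup>2 - \<beta>) - \<gamma> * \<rho> * (L + d \<rho>)"
  proof (rule order_tendstoD(1))
    show "((\<lambda>\<rho>. 2 * (\<rho>\<^sup>2 - \<beta>) - \<gamma> * \<rho> * (L + d \<rho>)) \<longlongrightarrow> 2 * (1\<^sup>2 - \<beta>) - \<gamma> * 1 * (L + 0)) (at_right 1)"
      by (intro tendsto_intros d)
    show "0 < 2 * (1\<^sup>2 - \<beta>) - \<gamma> * 1 * (L + 0)" using assms by simp
  qed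
  ultimately have "\<forall>\<^sub>F \<rho> in at_right 1. 1 < \<rho> \<and> (\<forall>l\<in>E \<inter> {..<0}. d \<rho> < - l) \<and> 0 < 2 * (\<rho>\<^sup>2 - \<beta>) - \<gamma> * \<rho> * (L + d \<rho>)"
    using eventually_at_right_less[of "1::real"] by eventually_elim auto
  then obtain \<rho> where "1 < \<rho>" "\<forall>l\<in>E \<inter> {..<0}. d \<rho> < - l" "0 < 2 * (\<rho>\<^sup>2 - \<beta>) - \<gamma> * \<rho> * (L + d \<rho>)"
    using eventually_happens'[OF trivial_limit_at_right_real] by blast
  moreover from \<open>1 < \<rho>\<close> have "d \<rho> > 0" "\<gamma> * \<rho> * d \<rho> = (\<rho> - 1) * (\<rho> - \<beta>)"
    using assms by (simp_all add: d_def)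
  ultimately show thesis using that[of \<rho> "d \<rho>"] by auto
qed

text \<open>The expanded form is the negative of the energy of the rescaled recursion. It is
  positive in the unstable direction, where the potential energy of \<open>K = T + \<delta>\<close> is negative. Its
  expansion by more than the factor \<open>\<rho>\<^sup>2\<close> is the dissipation of energy: the step size bound makes
  the dissipated amount positive unless both velocities \<open>U\<close> and \<open>U'\<close> vanish, and in that case the
  state is an equilibrium of the rescaled recursion, hence zero because \<open>K\<close> is injective.\<close>

lemma heavy_ball_expanded_form:
  fixes T :: "'a::euclidean_space \<Rightarrow> 'a" and \<beta> \<gamma> L :: real
  assumes T: "linear T" and sa: "\<And>x y. x \<bullet> T y = y \<bullet> T x"
    and fin: "finite {l. \<exists>v. v \<noteq> 0 \<and> T v = l *\<^sub>R v}"
    and L: "\<And>x. x \<bullet> T x \<le> L * (norm x)\<^sup>2"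
    and v: "v \<noteq> 0" "T v = l *\<^sub>R v" "l < 0"
    and \<beta>: "0 < \<beta>" "\<beta> < 1" and \<gamma>: "0 < \<gamma>" "\<gamma> * L < 2 * (1 - \<beta>)"
  obtains B m w where "bounded_bilinear (B :: 'a \<times> 'a \<Rightarrow> 'a \<times> 'a \<Rightarrow> real)" "m > 1" "B w w > 0"
    "\<forall>a b. (a, b) \<noteq> 0 \<longrightarrow> m * B (a, b) (a, b)
       < B (b, b - \<gamma> *\<^sub>R T b + \<beta> *\<^sub>R (b - a)) (b, b - \<gamma> *\<^sub>R T b + \<beta> *\<^sub>R (b - a))"
proof -
  define E where "E = {l. \<exists>v. v \<noteq> 0 \<and> T v = l *\<^sub>R v}"
  obtain \<rho> \<delta> where \<rho>: "\<rho> > 1" and \<delta>: "\<delta> > 0" "\<gamma> * \<rho> * \<delta> = (\<rho> - 1) * (\<rho> - \<beta>)"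
    and gap: "\<forall>k\<in>E. k < 0 \<longrightarrow> \<delta> < - k"
    and rate: "\<gamma> * \<rho> * (L + \<delta>) < 2 * (\<rho>\<^sup>2 - \<beta>)"
    using heavy_ball_rate_exists[OF fin[folded E_def] \<beta>(2) \<gamma>] .
  define K where "K x = T x + \<delta> *\<^sub>R x" for x
  define B :: "'a \<times> 'a \<Rightarrow> 'a \<times> 'a \<Rightarrow> real" where
    "B d e = - (\<gamma> * \<rho> * (snd d \<bullet> K (snd e)) + \<beta> * ((snd d - \<rho> *\<^sub>R fst d) \<bullet> (snd e - \<rho> *\<^sub>R fst e)))" for d e
  have K: "K (x + y) = K x + K y" "K (c *\<^sub>R x) = c *\<^sub>R K x" for x y c
    by (simp_all add: K_def linear_add[OF T] linear_scale[OF T] algebra_simps)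
  have K0: "x = 0" if "K x = 0" for x
  proof (rule ccontr)
    assume "x \<noteq> 0"
    moreover have "T x = (- \<delta>) *\<^sub>R x" using that by (simp add: K_def eq_neg_iff_add_eq_0)
    ultimately have "- \<delta> \<in> E" unfolding E_def by blast
    then show False using gap \<delta>(1) by force
  qed
  have "bilinear B"
    unfolding bilinear_def B_def
    by (auto intro!: linearI simp: K inner_add_left inner_add_right inner_diff_left inner_diff_right algebra_simps)
  then have "bounded_bilinear B" by (simp add: bilinear_conv_bounded_bilinear)
  moreover have "\<rho>\<^sup>2 > 1" using \<rho> by simp
  \<comment> \<open>The state with second component \<open>v\<close> and zero rescaled velocity: only the potential energy
    is left.\<close>
  moreover have "B (v /\<^sub>R \<rho>, v) (v /\<^sub>R \<rho>, v) > 0"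
  proof -
    have "v \<bullet> K v = (l + \<delta>) * (v \<bullet> v)" by (simp add: K_def v(2) inner_add_right algebra_simps)
    moreover have "l + \<delta> < 0" using gap v by (force simp: E_def)
    ultimately have "v \<bullet> K v < 0" using v(1) by (simp add: mult_neg_pos)
    then show ?thesis using \<rho> \<gamma>(1) by (simp add: B_def mult_pos_neg)
  qed
  moreover have "\<rho>\<^sup>2 * B (a, b) (a, b)
      < B (b, b - \<gamma> *\<^sub>R T b + \<beta> *\<^sub>R (b - a)) (b, b - \<gamma> *\<^sub>R T b + \<beta> *\<^sub>R (b - a))"
    if "(a, b) \<noteq> 0" for a b
  proof -
    define U where "U = b - \<rho> *\<^sub>R a"
    define b' where "b' = b - \<gamma> *\<^sub>R T b + \<beta> *\<^sub>R (b - a)"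
    define U' where "U' = b' - \<rho> *\<^sub>R b"
    note g = heavy_ball_form_growth[OF T sa, of \<rho> \<gamma> \<delta> \<beta> b a, folded K_def,
        folded U_def b'_def, folded U'_def]
    have \<rho>0: "\<rho> \<noteq> 0" using \<rho> by simp
    have "U' \<bullet> K U' \<le> (L + \<delta>) * (norm U')\<^sup>2"
      using L[of U'] by (simp add: K_def inner_add_right power2_norm_eq_inner algebra_simps)
    then have "\<gamma> * \<rho> * (U' \<bullet> K U') \<le> \<gamma> * \<rho> * ((L + \<delta>) * (norm U')\<^sup>2)"
      using \<gamma>(1) \<rho> by (intro mult_left_mono) auto
    then have k: "\<gamma> * \<rho> * (U' \<bullet> K U') \<le> \<gamma> * \<rho> * (L + \<delta>) * (norm U')\<^sup>2"
      by (simp only: mult.assoc)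
    have "0 < \<beta> * (norm (\<rho> *\<^sub>R U - U'))\<^sup>2 + 2 * (\<rho>\<^sup>2 - \<beta>) * (norm U')\<^sup>2 - \<gamma> * \<rho> * (U' \<bullet> K U')"
    proof (cases "U' = 0")
      case True
      have "U \<noteq> 0"
      proof
        assume "U = 0"
        then have "K b = 0" using g(1)[OF \<rho>0 \<delta>(2)] True \<rho>0 \<gamma>(1) by auto
        then have "b = 0" by (rule K0)
        then show False using \<open>U = 0\<close> \<rho> \<open>(a, b) \<noteq> 0\<close> by (simp add: U_def zero_prod_def)
      qed
      then show ?thesis using True \<beta>(1) \<rho>0 by simp
    next
      case False
      have "\<gamma> * \<rho> * (L + \<delta>) * (norm U')\<^sup>2 < 2 * (\<rho>\<^sup>2 - \<beta>) * (norm U')\<^sup>2"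
        using rate False by (intro mult_strict_right_mono) auto
      moreover have "0 \<le> \<beta> * (norm (\<rho> *\<^sub>R U - U'))\<^sup>2" using \<beta>(1) by simp
      ultimately show ?thesis using k by linarith
    qed
    then have "\<gamma> * \<rho> * (b' \<bullet> K b') + \<beta> * (U' \<bullet> U') < \<rho>\<^sup>2 * (\<gamma> * \<rho> * (b \<bullet> K b) + \<beta> * (U \<bullet> U))"
      unfolding g(2)[OF \<rho>0 \<delta>(2), symmetric] by simp
    moreover have "B (a, b) (a, b) = - (\<gamma> * \<rho> * (b \<bullet> K b) + \<beta> * (U \<bullet> U))"
      "B (b, b') (b, b') = - (\<gamma> * \<rho> * (b' \<bullet> K b') + \<beta> * (U' \<bullet> U'))"
      by (simp_all add: B_def U_def U'_def)
    ultimately have "\<rho>\<^sup>2 * B (a, b) (a, b) < B (b, b') (b, b')"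
      by (simp only: mult_minus_right neg_less_iff_less)
    then show ?thesis by (simp add: b'_def)
  qed
  ultimately show thesis by (intro that[of B "\<rho>\<^sup>2" "(v /\<^sub>R \<rho>, v)"]) blast+
qed

section \<open>Heavy-ball gradient descent near a strict saddle\<close>

text \<open>Pairs of consecutive iterates make the two-term recursion an ordinary dynamical system.\<close>

definition hbgd_step :: "(real^'n \<Rightarrow> real) \<Rightarrow> real \<Rightarrow> real \<Rightarrow> (real^'n) \<times> (real^'n) \<Rightarrow> (real^'n) \<times> (real^'n)" where
  "hbgd_step f \<gamma> \<beta> z = (snd z, snd z - \<gamma> *\<^sub>R gradient f (snd z) + \<beta> *\<^sub>R (snd z - fst z))"

lemma hbgd_step_funpow:
  "(hbgd_step f \<gamma> \<beta> ^^ k) (x0, x1) = (hbgd f \<gamma> \<beta> x0 x1 k, hbgd f \<gamma> \<beta> x0 x1 (Suc k))"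
  by (induction k) (simp_all add: hbgd_step_def)

definition hbgd_unstep :: "(real^'n \<Rightarrow> real) \<Rightarrow> real \<Rightarrow> real \<Rightarrow> (real^'n) \<times> (real^'n) \<Rightarrow> (real^'n) \<times> (real^'n)" where
  "hbgd_unstep f \<gamma> \<beta> z = ((1 / \<beta>) *\<^sub>R ((1 + \<beta>) *\<^sub>R fst z - \<gamma> *\<^sub>R gradient f (fst z) - snd z), fst z)"

text \<open>This is where \<open>\<beta> \<noteq> 0\<close> enters: the momentum term allows the older iterate to be recovered, so
  that the step has a differentiable inverse and preimages of negligible sets are negligible.\<close>

lemma hbgd_unstep_step:
  assumes "\<beta> \<noteq> 0"
  shows "hbgd_unstep f \<gamma> \<beta> (hbgd_step f \<gamma> \<beta> z) = z"
proof -
  have key: "(1 + \<beta>) *\<^sub>R b - \<gamma> *\<^sub>R g - (b - \<gamma> *\<^sub>R g + \<beta> *\<^sub>R (b - a)) = \<beta> *\<^sub>R a" for a b g :: "real^'n"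
    by (simp add: algebra_simps)
  have "hbgd_unstep f \<gamma> \<beta> (hbgd_step f \<gamma> \<beta> z) = ((1 / \<beta>) *\<^sub>R (\<beta> *\<^sub>R fst z), snd z)"
    by (simp only: hbgd_unstep_def hbgd_step_def fst_conv snd_conv key)
  then show ?thesis using assms by simp
qed

lemma hbgd_unstep_differentiable:
  fixes f :: "real^'n \<Rightarrow> real"
  assumes "C2 f"
  shows "hbgd_unstep f \<gamma> \<beta> differentiable_on UNIV"
proof -
  have "(\<lambda>z. gradient f (fst z)) differentiable (at z)" for z :: "(real^'n) \<times> (real^'n)"
    using has_derivative_compose[OF bounded_linear_imp_has_derivative[OF bounded_linear_fst] C2_hessian[OF assms]]
    unfolding differentiable_def by blast
  moreover have "(\<lambda>z. fst z) differentiable (at z)" "(\<lambda>z. snd z) differentiable (at z)" for z :: "(real^'n) \<times> (real^'n)"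
    by (simp_all add: bounded_linear_imp_differentiable bounded_linear_fst bounded_linear_snd)
  ultimately have "hbgd_unstep f \<gamma> \<beta> differentiable (at z)" for z
    unfolding hbgd_unstep_def[abs_def]
    by (intro differentiable_Pair differentiable_scaleR differentiable_diff differentiable_const) auto
  then show ?thesis by (simp add: differentiable_on_def)
qed

text \<open>The least eigenvalue is an actual eigenvalue only because the Hessian is symmetric: this makes the
  set of eigenvalues finite and nonempty.\<close>

lemma strict_saddle_negative_eigenvector:
  assumes "C2 f" "p \<in> strict_saddles f"
  obtains l v where "v \<noteq> 0" "hessian f p *v v = l *\<^sub>R v" "l < 0"
proof -
  note sa = C2_hessian_symmetric[OF \<open>C2 f\<close>, where x = p]
  have "finite (eigenvalues (hessian f p))"
    unfolding eigenvalues_def by (rule self_adjoint_finite_eigenvalues[OF sa])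
  moreover have "eigenvalues (hessian f p) \<noteq> {}"
    using self_adjoint_has_eigenvector[OF matrix_vector_mul_linear sa] unfolding eigenvalues_def by blast
  ultimately have "lambda_min (hessian f p) \<in> eigenvalues (hessian f p)"
    unfolding lambda_min_def by (rule Min_in)
  then show thesis using assms(2) that unfolding eigenvalues_def strict_saddles_def by blast
qed

lemma hbgd_step_strictly_differentiable:
  fixes f :: "real^'n \<Rightarrow> real" and p :: "real^'n" and \<gamma> \<beta> e :: real
  assumes "C2 f" "0 < \<gamma>" "0 < e"
  defines "A \<equiv> \<lambda>d. (snd d, snd d - \<gamma> *\<^sub>R (hessian f p *v snd d) + \<beta> *\<^sub>R (snd d - fst d))"
  shows "\<exists>r>0. \<forall>x\<in>ball (p, p) r. \<forall>y\<in>ball (p, p) r.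
           norm (hbgd_step f \<gamma> \<beta> x - hbgd_step f \<gamma> \<beta> y - A (x - y)) \<le> e * norm (x - y)"
proof -
  have cont: "continuous_on UNIV (hessian f)" using assms(1) by (simp add: C2_def)
  have "e / \<gamma> > 0" using assms by simp
  then obtain r where r: "r > 0" "\<And>x y. x \<in> ball p r \<Longrightarrow> y \<in> ball p r \<Longrightarrow>
      norm (gradient f x - gradient f y - hessian f p *v (x - y)) \<le> e / \<gamma> * norm (x - y)"
    using C1_strictly_differentiable[OF C2_hessian[OF assms(1)] cont] by blast
  have "norm (hbgd_step f \<gamma> \<beta> x - hbgd_step f \<gamma> \<beta> y - A (x - y)) \<le> e * norm (x - y)"
    if "x \<in> ball (p, p) r" "y \<in> ball (p, p) r" for x y
  proof -
    have in_ball: "snd z \<in> ball p r" if "z \<in> ball (p, p) r" for z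
      using that dist_snd_le[of "(p, p)" z] by simp
    let ?R = "gradient f (snd x) - gradient f (snd y) - hessian f p *v (snd x - snd y)"
    have "hbgd_step f \<gamma> \<beta> x - hbgd_step f \<gamma> \<beta> y - A (x - y) = (0, - (\<gamma> *\<^sub>R ?R))"
      by (simp add: hbgd_step_def A_def algebra_simps)
    then have "norm (hbgd_step f \<gamma> \<beta> x - hbgd_step f \<gamma> \<beta> y - A (x - y)) = \<gamma> * norm ?R"
      using assms(2) by (simp add: norm_Pair)
    also have "\<dots> \<le> \<gamma> * (e / \<gamma> * norm (snd x - snd y))"
      using r(2)[OF in_ball[OF that(1)] in_ball[OF that(2)]] assms(2) by (intro mult_left_mono) auto
    also have "\<dots> = e * norm (snd (x - y))" using assms(2) by simp
    also have "\<dots> \<le> e * norm (x - y)"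
      using assms(3) norm_snd_le[of "snd (x - y)" "fst (x - y)"] unfolding prod.collapse
      by (intro mult_left_mono) (assumption, simp)
    finally show ?thesis .
  qed
  then show ?thesis using r(1) by blast
qed

lemma negligible_trapped_near_strict_saddle:
  fixes f :: "real^'n \<Rightarrow> real"
  assumes C2: "C2 f" and L: "spectral_norm (hessian f p) \<le> L"
    and \<beta>: "0 < \<beta>" "\<beta> < 1" and \<gamma>: "0 < \<gamma>" "\<gamma> * L < 2 * (1 - \<beta>)"
    and p: "p \<in> strict_saddles f"
  shows "\<exists>r>0. negligible {z. \<forall>k. (hbgd_step f \<gamma> \<beta> ^^ k) z \<in> ball (p, p) r}"
proof -
  define T where "T = (*v) (hessian f p)"
  define A where "A d = (snd d, snd d - \<gamma> *\<^sub>R T (snd d) + \<beta> *\<^sub>R (snd d - fst d))" for d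
  have T: "linear T" by (simp add: T_def)
  have sa: "x \<bullet> T y = y \<bullet> T x" for x y
    unfolding T_def by (rule C2_hessian_symmetric[OF C2])
  have quad: "x \<bullet> T x \<le> L * (norm x)\<^sup>2" for x
  proof -
    have "norm (T x) \<le> onorm T * norm x" unfolding T_def by (intro onorm) simp
    also have "\<dots> \<le> L * norm x" using L by (intro mult_right_mono) (simp_all add: spectral_norm_def T_def)
    finally have "norm x * norm (T x) \<le> norm x * (L * norm x)" by (intro mult_left_mono) auto
    then show ?thesis using norm_cauchy_schwarz[of x "T x"] by (simp add: power2_eq_square mult_ac)
  qed
  obtain l v where v: "v \<noteq> 0" "T v = l *\<^sub>R v" "l < 0"
    using strict_saddle_negative_eigenvector[OF C2 p] unfolding T_def .
  obtain B and m :: real and w where B: "bounded_bilinear B" and m: "m > 1" and w: "B w w > 0"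
    and strict: "\<forall>a b. (a, b) \<noteq> 0 \<longrightarrow> m * B (a, b) (a, b)
       < B (b, b - \<gamma> *\<^sub>R T b + \<beta> *\<^sub>R (b - a)) (b, b - \<gamma> *\<^sub>R T b + \<beta> *\<^sub>R (b - a))"
    using heavy_ball_expanded_form[OF T sa self_adjoint_finite_eigenvalues[OF sa] quad v \<beta> \<gamma>] .
  have A: "linear A"
    by (rule linearI) (simp_all add: A_def linear_add[OF T] linear_scale[OF T] algebra_simps)
  show ?thesis
  proof (rule negligible_locally_trapped_set[OF B w A m])
    show "m * B d d < B (A d) (A d)" if "d \<noteq> 0" for d
      using strict[rule_format, of "fst d" "snd d"] that by (simp add: A_def)
    show "\<exists>r>0. \<forall>x\<in>ball (p, p) r. \<forall>y\<in>ball (p, p) r.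
        norm (hbgd_step f \<gamma> \<beta> x - hbgd_step f \<gamma> \<beta> y - A (x - y)) \<le> e * norm (x - y)" if "e > 0" for e
      using hbgd_step_strictly_differentiable[OF C2 \<gamma>(1) that] by (simp add: A_def T_def)
  qed
qed

theorem lemma2:
  fixes f :: "real^'n \<Rightarrow> real" and L \<gamma> \<beta> :: real
  assumes "C2 f"
    and "L > 0"
    and "\<And>x. spectral_norm (hessian f x) \<le> L"
    and "bdd_below (range f)"
    and "0 < \<beta>" and "\<beta> < 1"
    and "0 < \<gamma>" and "\<gamma> < 2 * (1 - \<beta>) / L"
  shows "W_HBGD f \<gamma> \<beta> \<in> null_sets lebesgue"
proof -
  let ?X = "(\<lambda>p. (p, p)) ` strict_saddles f"
  have "\<gamma> * L < 2 * (1 - \<beta>)" using assms(2,8) by (simp add: pos_less_divide_eq)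
  then have "negligible {z. \<exists>q\<in>?X. (\<lambda>k. (hbgd_step f \<gamma> \<beta> ^^ k) z) \<longlonglongrightarrow> q}"
    using negligible_trapped_near_strict_saddle[OF assms(1,3,5,6,7)] assms(5)
    by (intro negligible_basin[of "hbgd_unstep f \<gamma> \<beta>"] hbgd_unstep_step hbgd_unstep_differentiable[OF assms(1)]) auto
  moreover have "W_HBGD f \<gamma> \<beta> \<subseteq> {z. \<exists>q\<in>?X. (\<lambda>k. (hbgd_step f \<gamma> \<beta> ^^ k) z) \<longlonglongrightarrow> q}"
  proof
    fix z assume "z \<in> W_HBGD f \<gamma> \<beta>"
    then obtain x0 x1 l where z: "z = (x0, x1)" and l: "l \<in> strict_saddles f" "hbgd f \<gamma> \<beta> x0 x1 \<longlonglongrightarrow> l"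
      by (auto simp: W_HBGD_def)
    have "(\<lambda>k. (hbgd f \<gamma> \<beta> x0 x1 k, hbgd f \<gamma> \<beta> x0 x1 (Suc k))) \<longlonglongrightarrow> (l, l)"
      using l(2) LIMSEQ_Suc[OF l(2)] by (intro tendsto_Pair)
    then have "(\<lambda>k. (hbgd_step f \<gamma> \<beta> ^^ k) z) \<longlonglongrightarrow> (l, l)" by (simp only: z hbgd_step_funpow)
    then show "z \<in> {z. \<exists>q\<in>?X. (\<lambda>k. (hbgd_step f \<gamma> \<beta> ^^ k) z) \<longlonglongrightarrow> q}" using l(1) by blast
  qed
  ultimately show ?thesis
    using negligible_subset negligible_iff_null_sets by blast
qed

end
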